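(* Let the system $x_{k+1}=A(p_k)x_k+Bu_k$, $k\in\mathbb{N}$, be polytopic (with functions $\xi_i$ and matrices $A_i$, $i\in\mathcal{N}$), and consider the statements: (T4.1) The system is poly-Q stabilizable with $$K(k,\bm{p})=\sum_{i,j\in\mathcal{N}}\xi_i(p_k)\xi_j(p_{k+1})\bar{K}_{ij}X_{ij}\Big(\sum_{m\in\mathcal{N}}\xi_m(p_{k+1})X_{im}\Big)^{-1}$$ for some $\bar{K}_{ij}\in\mathbb{R}^{n_u\times n_x}$, $X_{ij}\in\mathbb{R}^{n_x\times n_x}$, $i,j\in\mathcal{N}$. (T4.2) The system is poly-Q stabilizable with $K(k,\bm{p})=\sum_{i\in\mathcal{N}}\xi_i(p_k)\bar{K}_i$ for some $\bar{K}_i\in\mathbb{R}^{n_u\times n_x}$, $i\in\mathcal{N}$. (T4.3) There exist matrices $\bar{P}_i\in\mathbb{S}^{n_x}$, $\bar{S}_i=\bar{P}_i^{-1}$, $\bar{K}_i\in\mathbb{R}^{n_u\times n_x}$ and $Y_i=\bar{K}_i\bar{S}_i$, $i\in\mathcal{N}$, such that $$\begin{bmatrix}\bar{S}_i & \star\\ A_i\bar{S}_i+BY_i & \bar{S}_j\end{bmatrix}\succ 0\quad\text{for all } i,j\in\mathcal{N}.$$ (T4.4) There exist matrices $\bar{P}_i\in\mathbb{S}^{n_x}$, $\bar{S}_i=\bar{P}_i^{-1}$, $X_{ij}\in\mathbb{R}^{n_x\times n_x}$, $\bar{K}_{ij}\in\mathbb{R}^{n_u\times n_x}$, $Y_{ij}=\bar{K}_{ij}X_{ij}$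 and $Z_i\in\mathbb{R}^{n_x\times n_x}$, $i,j\in\mathcal{N}$, such that $$\begin{bmatrix} X_{ij}+X_{ij}^\top-\bar{S}_i & \star & \star\\ A_iX_{ij}+BY_{ij} & Z_i+Z_i^\top & \star\\ 0 & Z_i & \bar{S}_j\end{bmatrix}\succ 0\quad\text{for all } i,j\in\mathcal{N}.$$ Then (T4.2) $\Rightarrow$ (T4.1) with $\bar{K}_{ij}=\bar{K}_i$ and $X_{ij}=I$, $i,j\in\mathcal{N}$. Moreover, (T4.3) $\Rightarrow$ (T4.2) with the same $\bar{K}_i$, $i\in\mathcal{N}$, and (T4.4) $\Rightarrow$ (T4.1) with the same $\bar{K}_{ij}$ and $X_{ij}$, $i,j\in\mathcal{N}$. If (T4.3) or (T4.4) holds, then $V(\pi,x)=x^\top\big(\sum_{i\in\mathcal{N}}\xi_i(\pi)\bar{P}_i\big)x$ (with the matrices $\bar{P}_i$ from that statement) is a poly-QLF for the corresponding closed-loop system $x_{k+1}=(A(p_k)+BK(k,\bm{p}))x_k$. Any matrices $X_{ij}$, $i,j\in\mathcal{N}$, satisfying the inequalities in (T4.4) are such that $X_i(\pi)=\sum_{j\in\mathcal{N}}\xi_j(\pi)X_{ij}$, $i\in\mathcal{N}$, are non-singular for all $\pi\in\mathbb{P}$. If the system is also strictly polytopic, then (T4.2) $\Leftrightarrow$ (T4.3).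
   Context: Notation: $\mathbb{N}=\{0,1,2,\dots\}$; $\mathbb{S}^n$ is the set of symmetric $n\times n$ real matrices; $M\succ 0$ means $M$ is symmetric positive definite; $\star$ denotes blocks completing a symmetric matrix; $I$ is the identity matrix. Setting: $\mathbb{P}\subseteq\mathbb{R}^{n_p}$ is a known compact set, $A\colon\mathbb{P}\to\mathbb{R}^{n_x\times n_x}$, $B\in\mathbb{R}^{n_x\times n_u}$. $\mathcal{P}$ is the set of all sequences $\bm{p}=\{p_k\}_{k\in\mathbb{N}}$ with $p_k\in\mathbb{P}$ for all $k$. Let $\mathcal{N}=\{1,\dots,N\}$. Polytopic: the system is polytopic if there exist continuous functions $\xi_i\colon\mathbb{P}\to\mathbb{R}_{\geqslant 0}$, $i\in\mathcal{N}$, with $\sum_{i\in\mathcal{N}}\xi_i(\pi)=1$ for all $\pi\in\mathbb{P}$, and matrices $A_i\in\mathbb{R}^{n_x\times n_x}$, $i\in\mathcal{N}$, such that $A(\pi)=\sum_{i\in\mathcal{N}}\xi_i(\pi)A_i$ for all $\pi\in\mathbb{P}$. It is strictly polytopic if, in addition, every unit vector $\bm{e}_i\in\mathbb{R}^N$, $i\in\mathcal{N}$, belongs to $\xi(\mathbb{P})$, where $\xi=(\xi_1,\dots,\xi_N)$. Poly-QS: a system $x_{k+1}=F(k,\bm{p})x_k$ with $F\colon\mathbb{N}\times\mathcal{P}\to\mathbb{R}^{n_x\times n_x}$ is poly-quadratically stable (poly-QS) if it admits a poly-quadratic Lyapunov function (poly-QLF), i.e., a function $V(\pi,x)=x^\top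 P(\pi)x$ with $P(\pi)=\sum_{i\in\mathcal{N}}\xi_i(\pi)\bar{P}_i$, $\bar{P}_i\in\mathbb{S}^{n_x}$ (with the same functions $\xi_i$ as for $A$), such that for some $a_1,a_2,a_3>0$: $a_1\|x\|^2\leqslant V(\pi,x)\leqslant a_2\|x\|^2$ for all $\pi\in\mathbb{P}$, $x\in\mathbb{R}^{n_x}$, and $V(p_{k+1},F(k,\bm{p})x)\leqslant V(p_k,x)-a_3\|x\|^2$ for all $k\in\mathbb{N}$, $\bm{p}\in\mathcal{P}$, $x\in\mathbb{R}^{n_x}$. Poly-Q stabilizability: with state feedback $u_k=K(k,\bm{p})x_k$, the closed-loop system is $x_{k+1}=(A(p_k)+BK(k,\bm{p}))x_k$. The system is poly-Q stabilizable if there exists a function $K\colon\mathbb{N}\times\mathcal{P}\to\mathbb{R}^{n_u\times n_x}$ that renders the closed-loop system poly-QS; "poly-Q stabilizable with $K$" means that this particular $K$ (which must be well defined, i.e., the inverses occurring in it exist) renders the closed-loop system poly-QS. *)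

theory Defs
  imports "HOL-Analysis.Analysis"
begin

definition symmetric_mat :: "real^'n^'n \<Rightarrow> bool"
  where "symmetric_mat M \<longleftrightarrow> transpose M = M"

definition pos_def :: "real^'n^'n \<Rightarrow> bool"
  where "pos_def M \<longleftrightarrow> symmetric_mat M \<and> (\<forall>x. x \<noteq> 0 \<longrightarrow> x \<bullet> (M *v x) > 0)"

text \<open>The type \<^typ>\<open>real^'n^'m\<close> has rows indexed by \<^typ>\<open>'m\<close> and columns indexed by
  \<^typ>\<open>'n\<close>; blocks are indexed by sum types.\<close>

definition stack_rows :: "real^'n^'a \<Rightarrow> real^'n^'b \<Rightarrow> real^'n^('a + 'b)"
  where "stack_rows U L = (\<chi> i. case i of Inl a \<Rightarrow> U $ a | Inr b \<Rightarrow> L $ b)"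

definition block_mat ::
    "real^'c^'a \<Rightarrow> real^'d^'a \<Rightarrow> real^'c^'b \<Rightarrow> real^'d^'b \<Rightarrow> real^('c + 'd)^('a + 'b)"
  where "block_mat M11 M12 M21 M22 =
    (\<chi> i j. case i of
        Inl a \<Rightarrow> (case j of Inl c \<Rightarrow> M11 $ a $ c | Inr d \<Rightarrow> M12 $ a $ d)
      | Inr b \<Rightarrow> (case j of Inl c \<Rightarrow> M21 $ b $ c | Inr d \<Rightarrow> M22 $ b $ d))"

text \<open>The lower block triangle is given; the blocks above the diagonal are the transposes of
  those below it. The diagonal blocks are taken as they are, so the result is symmetric exactly
  if they are.\<close>

definition sym_block2 :: "real^'a^'a \<Rightarrow> real^'a^'b \<Rightarrow> real^'b^'b \<Rightarrow> real^('a + 'b)^('a + 'b)"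
  where "sym_block2 M11 M21 M22 = block_mat M11 (transpose M21) M21 M22"

definition sym_block3 ::
    "real^'a^'a \<Rightarrow> real^'a^'b \<Rightarrow> real^'b^'b \<Rightarrow> real^'a^'c \<Rightarrow> real^'b^'c \<Rightarrow> real^'c^'c
      \<Rightarrow> real^('a + ('b + 'c))^('a + ('b + 'c))"
  where "sym_block3 M11 M21 M22 M31 M32 M33 =
    sym_block2 M11 (stack_rows M21 M31) (sym_block2 M22 M32 M33)"

text \<open>The finite index set \<open>{1,\<dots>,N}\<close> is the finite type \<^typ>\<open>'m\<close>; the compact parameter set
  is \<open>PP\<close>.\<close>

definition polytopic ::
    "(real^'p) set \<Rightarrow> (real^'p \<Rightarrow> real^'x^'x) \<Rightarrow> ('m::finite \<Rightarrow> real^'p \<Rightarrow> real)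
      \<Rightarrow> ('m \<Rightarrow> real^'x^'x) \<Rightarrow> bool"
  where "polytopic PP A \<xi> Av \<longleftrightarrow>
    (\<forall>i. continuous_on PP (\<xi> i)) \<and>
    (\<forall>i. \<forall>\<pi>\<in>PP. \<xi> i \<pi> \<ge> 0) \<and>
    (\<forall>\<pi>\<in>PP. (\<Sum>i\<in>UNIV. \<xi> i \<pi>) = 1) \<and>
    (\<forall>\<pi>\<in>PP. A \<pi> = (\<Sum>i\<in>UNIV. \<xi> i \<pi> *\<^sub>R Av i))"

definition strictly_polytopic ::
    "(real^'p) set \<Rightarrow> (real^'p \<Rightarrow> real^'x^'x) \<Rightarrow> ('m::finite \<Rightarrow> real^'p \<Rightarrow> real)
      \<Rightarrow> ('m \<Rightarrow> real^'x^'x) \<Rightarrow> bool"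
  where "strictly_polytopic PP A \<xi> Av \<longleftrightarrow>
    polytopic PP A \<xi> Av \<and> (\<forall>i. axis i 1 \<in> (\<lambda>\<pi>. \<chi> j. \<xi> j \<pi>) ` PP)"

definition param_seqs :: "(real^'p) set \<Rightarrow> (nat \<Rightarrow> real^'p) set"
  where "param_seqs PP = {p. \<forall>k. p k \<in> PP}"

definition poly_quad ::
    "('m::finite \<Rightarrow> real^'p \<Rightarrow> real) \<Rightarrow> ('m \<Rightarrow> real^'x^'x) \<Rightarrow> real^'p \<Rightarrow> real^'x \<Rightarrow> real"
  where "poly_quad \<xi> Pb \<pi> x = x \<bullet> ((\<Sum>i\<in>UNIV. \<xi> i \<pi> *\<^sub>R Pb i) *v x)"

text \<open>A system is given by its transition map \<open>F\<close>, which may depend on time and on the whole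
  parameter sequence. Only the values of \<open>V\<close> for parameters in \<open>PP\<close> and of \<open>F\<close> on
  \<open>param_seqs PP\<close> matter.\<close>

definition poly_QLF ::
    "(real^'p) set \<Rightarrow> ('m::finite \<Rightarrow> real^'p \<Rightarrow> real)
      \<Rightarrow> (nat \<Rightarrow> (nat \<Rightarrow> real^'p) \<Rightarrow> real^'x^'x) \<Rightarrow> (real^'p \<Rightarrow> real^'x \<Rightarrow> real) \<Rightarrow> bool"
  where "poly_QLF PP \<xi> F V \<longleftrightarrow>
    (\<exists>Pb. (\<forall>i. symmetric_mat (Pb i)) \<and> (\<forall>\<pi>\<in>PP. \<forall>x. V \<pi> x = poly_quad \<xi> Pb \<pi> x)) \<and>
    (\<exists>a1>0. \<exists>a2>0. \<exists>a3>0.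
      (\<forall>\<pi>\<in>PP. \<forall>x. a1 * (norm x)\<^sup>2 \<le> V \<pi> x \<and> V \<pi> x \<le> a2 * (norm x)\<^sup>2) \<and>
      (\<forall>k. \<forall>p\<in>param_seqs PP. \<forall>x.
        V (p (k + 1)) (F k p *v x) \<le> V (p k) x - a3 * (norm x)\<^sup>2))"

definition poly_QS ::
    "(real^'p) set \<Rightarrow> ('m::finite \<Rightarrow> real^'p \<Rightarrow> real)
      \<Rightarrow> (nat \<Rightarrow> (nat \<Rightarrow> real^'p) \<Rightarrow> real^'x^'x) \<Rightarrow> bool"
  where "poly_QS PP \<xi> F \<longleftrightarrow> (\<exists>V. poly_QLF PP \<xi> F V)"

definition closed_loop ::
    "(real^'p \<Rightarrow> real^'x^'x) \<Rightarrow> real^'u^'x \<Rightarrow> (nat \<Rightarrow> (nat \<Rightarrow> real^'p) \<Rightarrow> real^'x^'u)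
      \<Rightarrow> nat \<Rightarrow> (nat \<Rightarrow> real^'p) \<Rightarrow> real^'x^'x"
  where "closed_loop A B K k p = A (p k) + B ** K k p"

definition poly_Q_stabilizable_with ::
    "(real^'p) set \<Rightarrow> ('m::finite \<Rightarrow> real^'p \<Rightarrow> real) \<Rightarrow> (real^'p \<Rightarrow> real^'x^'x) \<Rightarrow> real^'u^'x
      \<Rightarrow> (nat \<Rightarrow> (nat \<Rightarrow> real^'p) \<Rightarrow> real^'x^'u) \<Rightarrow> bool"
  where "poly_Q_stabilizable_with PP \<xi> A B K \<longleftrightarrow> poly_QS PP \<xi> (closed_loop A B K)"

definition gain_X ::
    "('m::finite \<Rightarrow> real^'p \<Rightarrow> real) \<Rightarrow> ('m \<Rightarrow> 'm \<Rightarrow> real^'x^'u) \<Rightarrow> ('m \<Rightarrow> 'm \<Rightarrow> real^'x^'x)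
      \<Rightarrow> nat \<Rightarrow> (nat \<Rightarrow> real^'p) \<Rightarrow> real^'x^'u"
  where "gain_X \<xi> Kb X k p =
    (\<Sum>i\<in>UNIV. \<Sum>j\<in>UNIV. (\<xi> i (p k) * \<xi> j (p (k + 1))) *\<^sub>R
      (Kb i j ** X i j ** matrix_inv (\<Sum>m\<in>UNIV. \<xi> m (p (k + 1)) *\<^sub>R X i m)))"

text \<open>\<^const>\<open>matrix_inv\<close> is total, so the existence of the inverses is a separate condition.\<close>

definition gain_X_well_defined ::
    "(real^'p) set \<Rightarrow> ('m::finite \<Rightarrow> real^'p \<Rightarrow> real) \<Rightarrow> ('m \<Rightarrow> 'm \<Rightarrow> real^'x^'x) \<Rightarrow> bool"
  where "gain_X_well_defined PP \<xi> X \<longleftrightarrow>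
    (\<forall>k. \<forall>p\<in>param_seqs PP. \<forall>i. invertible (\<Sum>m\<in>UNIV. \<xi> m (p (k + 1)) *\<^sub>R X i m))"

definition gain_poly ::
    "('m::finite \<Rightarrow> real^'p \<Rightarrow> real) \<Rightarrow> ('m \<Rightarrow> real^'x^'u)
      \<Rightarrow> nat \<Rightarrow> (nat \<Rightarrow> real^'p) \<Rightarrow> real^'x^'u"
  where "gain_poly \<xi> Kb k p = (\<Sum>i\<in>UNIV. \<xi> i (p k) *\<^sub>R Kb i)"

definition stabilizable_gain_X ::
    "(real^'p) set \<Rightarrow> ('m::finite \<Rightarrow> real^'p \<Rightarrow> real) \<Rightarrow> (real^'p \<Rightarrow> real^'x^'x) \<Rightarrow> real^'u^'x
      \<Rightarrow> ('m \<Rightarrow> 'm \<Rightarrow> real^'x^'u) \<Rightarrow> ('m \<Rightarrow> 'm \<Rightarrow> real^'x^'x) \<Rightarrow> bool"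
  where "stabilizable_gain_X PP \<xi> A B Kb X \<longleftrightarrow>
    gain_X_well_defined PP \<xi> X \<and> poly_Q_stabilizable_with PP \<xi> A B (gain_X \<xi> Kb X)"

definition stabilizable_gain_poly ::
    "(real^'p) set \<Rightarrow> ('m::finite \<Rightarrow> real^'p \<Rightarrow> real) \<Rightarrow> (real^'p \<Rightarrow> real^'x^'x) \<Rightarrow> real^'u^'x
      \<Rightarrow> ('m \<Rightarrow> real^'x^'u) \<Rightarrow> bool"
  where "stabilizable_gain_poly PP \<xi> A B Kb \<longleftrightarrow>
    poly_Q_stabilizable_with PP \<xi> A B (gain_poly \<xi> Kb)"

definition LMI_poly ::
    "('m::finite \<Rightarrow> real^'x^'x) \<Rightarrow> real^'u^'x \<Rightarrow> ('m \<Rightarrow> real^'x^'x) \<Rightarrow> ('m \<Rightarrow> real^'x^'u) \<Rightarrow> bool"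
  where "LMI_poly Av B Pb Kb \<longleftrightarrow>
    (\<forall>i. symmetric_mat (Pb i) \<and> invertible (Pb i)) \<and>
    (let S = (\<lambda>i. matrix_inv (Pb i)); Y = (\<lambda>i. Kb i ** S i)
     in \<forall>i j. pos_def (sym_block2 (S i) (Av i ** S i + B ** Y i) (S j)))"

definition LMI_X ::
    "('m::finite \<Rightarrow> real^'x^'x) \<Rightarrow> real^'u^'x \<Rightarrow> ('m \<Rightarrow> real^'x^'x) \<Rightarrow> ('m \<Rightarrow> 'm \<Rightarrow> real^'x^'x)
      \<Rightarrow> ('m \<Rightarrow> 'm \<Rightarrow> real^'x^'u) \<Rightarrow> ('m \<Rightarrow> real^'x^'x) \<Rightarrow> bool"
  where "LMI_X Av B Pb X Kb Z \<longleftrightarrow>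
    (\<forall>i. symmetric_mat (Pb i) \<and> invertible (Pb i)) \<and>
    (let S = (\<lambda>i. matrix_inv (Pb i)); Y = (\<lambda>i j. Kb i j ** X i j)
     in \<forall>i j. pos_def (sym_block3
          (X i j + transpose (X i j) - S i)
          (Av i ** X i j + B ** Y i j) (Z i + transpose (Z i))
          0                            (Z i)                    (S j)))"

end

theory Submission
  imports Defs
begin

text \<open>The LMIs are congruent to inequalities free of inverses: with \<open>x = P\<^sub>i u\<close>, \<open>y = P\<^sub>j w\<close> the form of
  (T4.3) becomes \<open>u\<^sup>T P\<^sub>i u + 2 w\<^sup>T P\<^sub>j (A\<^sub>i + B K\<^sub>i) u + w\<^sup>T P\<^sub>j w\<close>. This is affine in the data of each
  vertex, so it survives convex combination over \<open>i\<close> and \<open>j\<close>, and \<open>w = - F u\<close> then gives the decrease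
  of \<open>V\<close>, without Schur complements. For (T4.4), \<open>x = X\<^sub>i(\<pi>)\<^sup>-\<^sup>1 u\<close> and
  \<open>2 x\<^sup>T u - x\<^sup>T S\<^sub>i x \<le> u\<^sup>T P\<^sub>i u\<close> lead to the same inequality. Conversely, evaluating a
  Lyapunov function at parameters mapped to unit vectors gives (T4.3) by completing the square.\<close>

section \<open>Block vectors and the quadratic forms of symmetric block matrices\<close>

text \<open>The vector counterpart of \<open>stack_rows\<close>. Every vector over a sum type has
  this form, so a block form need only be tested on such vectors.\<close>

definition join :: "real^'a \<Rightarrow> real^'b \<Rightarrow> real^('a + 'b)"
  where "join x y = (\<chi> i. case i of Inl a \<Rightarrow> x $ a | Inr b \<Rightarrow> y $ b)"

lemma sum_UNIV_sum:
  fixes f :: "'a::finite + 'b::finite \<Rightarrow> real"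
  shows "(\<Sum>i\<in>UNIV. f i) = (\<Sum>a\<in>UNIV. f (Inl a)) + (\<Sum>b\<in>UNIV. f (Inr b))"
  by (subst UNIV_sum, subst sum.union_disjoint) (auto simp: sum.reindex)

lemma join_eqE:
  obtains x y where "z = join x y"
proof
  show "z = join (\<chi> a. z $ Inl a) (\<chi> b. z $ Inr b)"
    by (auto simp: join_def vec_eq_iff split: sum.split)
qed

lemma join_inner: "join x y \<bullet> join x' y' = x \<bullet> x' + y \<bullet> y'"
  by (simp add: join_def inner_vec_def sum_UNIV_sum)

lemma norm_join: "(norm (join x y))\<^sup>2 = (norm x)\<^sup>2 + (norm y)\<^sup>2"
  by (simp add: power2_norm_eq_inner join_inner)

lemma join_eq_0_iff: "join x y = 0 \<longleftrightarrow> x = 0 \<and> y = 0"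
  by (metis join_inner add_nonneg_eq_0_iff inner_eq_zero_iff inner_ge_zero)

lemma stack_rows_mult: "stack_rows U L *v x = join (U *v x) (L *v x)"
  by (simp add: stack_rows_def join_def vec_eq_iff matrix_vector_mult_def split: sum.split)

lemma block_mat_mult:
  "block_mat M11 M12 M21 M22 *v join x y = join (M11 *v x + M12 *v y) (M21 *v x + M22 *v y)"
  by (simp add: block_mat_def join_def vec_eq_iff matrix_vector_mult_def sum_UNIV_sum
      split: sum.split)

text \<open>The off-diagonal blocks are transposes of each other and contribute equal amounts, hence
  the factor 2.\<close>

lemma inner_sym_block2:
  "join x y \<bullet> (sym_block2 M11 M21 M22 *v join x y) =
    x \<bullet> (M11 *v x) + 2 * (y \<bullet> (M21 *v x)) + y \<bullet> (M22 *v y)"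
proof -
  have "x \<bullet> (transpose M21 *v y) = y \<bullet> (M21 *v x)"
    by (metis dot_lmul_matrix inner_commute transpose_matrix_vector)
  then show ?thesis
    by (simp add: sym_block2_def block_mat_mult join_inner inner_add_right)
qed

lemma inner_sym_block3:
  "join x (join y z) \<bullet> (sym_block3 M11 M21 M22 M31 M32 M33 *v join x (join y z)) =
    x \<bullet> (M11 *v x) + 2 * (y \<bullet> (M21 *v x) + z \<bullet> (M31 *v x)) +
    (y \<bullet> (M22 *v y) + 2 * (z \<bullet> (M32 *v y)) + z \<bullet> (M33 *v z))"
  unfolding sym_block3_def inner_sym_block2 by (simp add: stack_rows_mult join_inner)

lemma symmetric_sym_block2:
  assumes "symmetric_mat M11" and "symmetric_mat M22"
  shows "symmetric_mat (sym_block2 M11 M21 M22)"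
  using assms
  by (auto simp: symmetric_mat_def sym_block2_def block_mat_def transpose_def vec_eq_iff
      split: sum.split)

section \<open>Symmetric, invertible and positive definite matrices\<close>

lemma symmetric_mat_inner:
  "symmetric_mat M \<Longrightarrow> (M *v x) \<bullet> y = x \<bullet> (M *v y)"
  by (metis dot_lmul_matrix inner_commute symmetric_mat_def transpose_matrix_vector)

lemma symmetric_mat_weighted_sum:
  "(\<And>i. symmetric_mat (M i)) \<Longrightarrow> symmetric_mat (\<Sum>i\<in>I. a i *\<^sub>R M i)"
  by (simp add: symmetric_mat_def transpose_def vec_eq_iff)

lemma matrix_inv_mult:
  fixes M :: "real^'n^'n"
  assumes "invertible M"
  shows "M ** matrix_inv M = mat 1" and "matrix_inv M ** M = mat 1"
proof -
  have "M ** matrix_inv M = mat 1 \<and> matrix_inv M ** M = mat 1"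
    using assms unfolding invertible_def matrix_inv_def by (rule someI_ex)
  then show "M ** matrix_inv M = mat 1" and "matrix_inv M ** M = mat 1"
    by simp_all
qed

lemma matrix_inv_mult_vec:
  fixes M :: "real^'n^'n"
  assumes "invertible M"
  shows "matrix_inv M *v (M *v x) = x" and "M *v (matrix_inv M *v x) = x"
  by (simp_all add: matrix_vector_mul_assoc matrix_inv_mult[OF assms])

lemma invertible_real_mat_iff:
  fixes M :: "real^'n^'n"
  shows "invertible M \<longleftrightarrow> (\<forall>x. M *v x = 0 \<longrightarrow> x = 0)"
  by (simp add: invertible_left_inverse matrix_left_invertible_ker)

lemma symmetric_mat_inv:
  fixes M :: "real^'n^'n"
  assumes "symmetric_mat M" and "invertible M"
  shows "symmetric_mat (matrix_inv M)"
  unfolding symmetric_mat_def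
  using assms(1) matrix_inv_mult[OF assms(2)]
  by (metis matrix_mul_assoc matrix_mul_lid matrix_mul_rid matrix_transpose_mul
      symmetric_mat_def transpose_mat)

lemma pos_def_invertible:
  fixes M :: "real^'n^'n"
  shows "pos_def M \<Longrightarrow> invertible M"
  unfolding invertible_real_mat_iff pos_def_def by (metis inner_zero_right less_irrefl)

text \<open>The form of the inverse at \<open>M *v x\<close> equals the form of \<open>M\<close> at
  \<open>x\<close>. The LMIs contain only the inverses of the \<open>Pb i\<close> as diagonal
  blocks, so definiteness has to be carried over this way.\<close>

lemma pos_def_if_inv:
  fixes M :: "real^'n^'n"
  assumes "symmetric_mat M" and "invertible M"
    and "\<And>x. x \<noteq> 0 \<Longrightarrow> x \<bullet> (matrix_inv M *v x) > 0"
  shows "pos_def M"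
  unfolding pos_def_def
proof (intro conjI allI impI)
  fix x :: "real^'n"
  assume "x \<noteq> 0"
  then have "M *v x \<noteq> 0"
    using assms(2) unfolding invertible_real_mat_iff by blast
  then have "(M *v x) \<bullet> (matrix_inv M *v (M *v x)) > 0"
    by (rule assms(3))
  then show "x \<bullet> (M *v x) > 0"
    by (simp add: matrix_inv_mult_vec[OF assms(2)] inner_commute)
qed (rule assms(1))

text \<open>The form attains a positive minimum on the compact unit sphere; homogeneity of degree 2
  extends the bound to all vectors.\<close>

lemma pos_def_bounded_below:
  fixes M :: "real^'n^'n"
  assumes "pos_def M"
  shows "\<exists>c>0. \<forall>x. c * (norm x)\<^sup>2 \<le> x \<bullet> (M *v x)"
proof -
  let ?S = "sphere (0::real^'n) 1"
  \<comment> \<open>Any unit vector will do: the sphere must be nonempty for the minimum to be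
    attained.\<close>
  have "axis undefined 1 \<in> ?S"
    by simp
  then have "?S \<noteq> {}"
    by blast
  moreover have "continuous_on ?S (\<lambda>x. x \<bullet> (M *v x))"
    by (intro continuous_intros linear_continuous_on matrix_vector_mul_bounded_linear)
  ultimately have "\<exists>z\<in>?S. \<forall>x\<in>?S. z \<bullet> (M *v z) \<le> x \<bullet> (M *v x)"
    by (rule continuous_attains_inf[OF compact_sphere])
  then obtain z where z: "z \<in> ?S" "\<And>x. x \<in> ?S \<Longrightarrow> z \<bullet> (M *v z) \<le> x \<bullet> (M *v x)"
    by blast
  let ?c = "z \<bullet> (M *v z)"
  have "z \<noteq> 0"
    using z(1) by auto
  then have "?c > 0"
    using assms by (simp add: pos_def_def)
  moreover have "?c * (norm x)\<^sup>2 \<le> x \<bullet> (M *v x)" for x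
  proof (cases "x = 0")
    case False
    have "?c \<le> (x /\<^sub>R norm x) \<bullet> (M *v (x /\<^sub>R norm x))"
      by (rule z(2)) (use False in simp)
    also have "\<dots> = (x \<bullet> (M *v x)) / (norm x)\<^sup>2"
      by (simp add: matrix_vector_mult_scaleR power2_eq_square field_simps)
    finally show ?thesis
      using False by (simp add: field_simps)
  qed simp
  ultimately show ?thesis
    by blast
qed

text \<open>With finitely many matrices the smallest of the constants is still positive, which gives
  one margin for all vertices.\<close>

lemma pos_def_uniformly_bounded_below:
  fixes M :: "'i::finite \<Rightarrow> real^'n^'n"
  assumes "\<And>i. pos_def (M i)"
  obtains c where "c > 0" and "\<And>i x. c * (norm x)\<^sup>2 \<le> x \<bullet> (M i *v x)"
proof -
  obtain d where d: "\<And>i. d i > 0" "\<And>i x. d i * (norm x)\<^sup>2 \<le> x \<bullet> (M i *v x)"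
    using pos_def_bounded_below[OF assms] by metis
  show thesis
  proof
    show "Min (range d) > 0"
      using d(1) by simp
    show "Min (range d) * (norm x)\<^sup>2 \<le> x \<bullet> (M i *v x)" for i x
      by (rule order_trans[OF mult_right_mono d(2)]) auto
  qed
qed

lemma matrix_vector_mult_bounded:
  fixes M :: "'i::finite \<Rightarrow> real^'n^'k"
  obtains C where "C > 0" and "\<And>i x. norm (M i *v x) \<le> C * norm x"
proof
  \<comment> \<open>The sum dominates each operator norm, and the summand 1 keeps the constant
    positive even if all matrices vanish.\<close>
  let ?C = "1 + (\<Sum>i\<in>UNIV. onorm ((*v) (M i)))"
  have nonneg: "onorm ((*v) (M i)) \<ge> 0" for i
    by (intro onorm_pos_le matrix_vector_mul_bounded_linear)
  then show "?C > 0"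
    by (simp add: add_pos_nonneg sum_nonneg)
  show "norm (M i *v x) \<le> ?C * norm x" for i x
  proof -
    have "norm (M i *v x) \<le> onorm ((*v) (M i)) * norm x"
      by (intro onorm matrix_vector_mul_bounded_linear)
    also have "onorm ((*v) (M i)) \<le> (\<Sum>i\<in>UNIV. onorm ((*v) (M i)))"
      by (rule member_le_sum) (auto simp: nonneg)
    then have "onorm ((*v) (M i)) * norm x \<le> ?C * norm x"
      by (intro mult_right_mono) auto
    finally show ?thesis .
  qed
qed

section \<open>Convex combinations of matrices, vectors and bounds\<close>

lemma weighted_sum_mult_vec:
  fixes M :: "'i \<Rightarrow> real^'n^'k"
  shows "(\<Sum>i\<in>I. a i *\<^sub>R M i) *v x = (\<Sum>i\<in>I. a i *\<^sub>R (M i *v x))"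
  by (induction I rule: infinite_finite_induct)
    (simp_all add: matrix_vector_mult_add_rdistrib scaleR_matrix_vector_assoc)

lemma mult_vec_weighted_sum:
  fixes M :: "real^'n^'k"
  shows "M *v (\<Sum>i\<in>I. a i *\<^sub>R x i) = (\<Sum>i\<in>I. a i *\<^sub>R (M *v x i))"
  by (simp add: linear_sum[OF matrix_vector_mul_linear] matrix_vector_mult_scaleR)

lemma norm_weighted_sum_le:
  fixes x :: "'i::finite \<Rightarrow> 'a::real_normed_vector"
  assumes "\<And>i. a i \<ge> 0" and "(\<Sum>i\<in>UNIV. a i) = 1" and "\<And>i. norm (x i) \<le> C"
  shows "norm (\<Sum>i\<in>UNIV. a i *\<^sub>R x i) \<le> C"
proof -
  have "norm (\<Sum>i\<in>UNIV. a i *\<^sub>R x i) \<le> (\<Sum>i\<in>UNIV. a i * C)"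
    by (rule sum_norm_le) (simp add: assms mult_left_mono)
  then show ?thesis
    by (simp add: assms(2) flip: sum_distrib_right)
qed

lemma weighted_sum_ge:
  fixes f :: "'i::finite \<Rightarrow> real"
  assumes "\<And>i. a i \<ge> 0" and "(\<Sum>i\<in>UNIV. a i) = 1" and "\<And>i. f i \<ge> c"
  shows "(\<Sum>i\<in>UNIV. a i * f i) \<ge> c"
proof -
  have "(\<Sum>i\<in>UNIV. a i * c) \<le> (\<Sum>i\<in>UNIV. a i * f i)"
    by (intro sum_mono mult_left_mono assms)
  then show ?thesis
    by (simp add: assms(2) flip: sum_distrib_right)
qed

section \<open>From vertex inequalities to a poly-quadratic Lyapunov function\<close>

text \<open>The vertex inequality is used at \<open>w = - F k p *v u\<close>, after averaging over \<open>i\<close>.\<close>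

lemma poly_QLF_if_vertex_ineqs:
  fixes \<xi> :: "'m::finite \<Rightarrow> real^'p \<Rightarrow> real" and Pb :: "'m \<Rightarrow> real^'x^'x"
  assumes poly: "polytopic PP A \<xi> Av"
    and Pb: "\<And>i. pos_def (Pb i)"
    and "c > 0"
    and F: "\<And>k p. p \<in> param_seqs PP \<Longrightarrow> F k p = (\<Sum>i\<in>UNIV. \<xi> i (p k) *\<^sub>R M i k p)"
    and vertex: "\<And>k p i u w. p \<in> param_seqs PP \<Longrightarrow>
      c * (norm u)\<^sup>2 \<le> u \<bullet> (Pb i *v u)
        + 2 * (w \<bullet> ((\<Sum>j\<in>UNIV. \<xi> j (p (k + 1)) *\<^sub>R Pb j) *v (M i k p *v u)))
        + poly_quad \<xi> Pb (p (k + 1)) w"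
  shows "poly_QLF PP \<xi> F (poly_quad \<xi> Pb)"
proof -
  have nonneg: "\<And>i \<pi>. \<pi> \<in> PP \<Longrightarrow> \<xi> i \<pi> \<ge> 0"
    and sum1: "\<And>\<pi>. \<pi> \<in> PP \<Longrightarrow> (\<Sum>i\<in>UNIV. \<xi> i \<pi>) = 1"
    using poly by (auto simp: polytopic_def)
  have quad: "poly_quad \<xi> Pb \<pi> x = (\<Sum>i\<in>UNIV. \<xi> i \<pi> * (x \<bullet> (Pb i *v x)))" for \<pi> x
    by (simp add: poly_quad_def weighted_sum_mult_vec inner_sum_right)
  obtain a1 where a1: "a1 > 0" "\<And>i x. a1 * (norm x)\<^sup>2 \<le> x \<bullet> (Pb i *v x)"
    by (rule pos_def_uniformly_bounded_below[of Pb, OF Pb], rule that)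
  obtain a2 where a2: "a2 > 0" "\<And>i x. norm (Pb i *v x) \<le> a2 * norm x"
    by (rule matrix_vector_mult_bounded[of Pb], rule that)
  have lower: "a1 * (norm x)\<^sup>2 \<le> poly_quad \<xi> Pb \<pi> x" if "\<pi> \<in> PP" for \<pi> x
    unfolding quad by (intro weighted_sum_ge nonneg sum1 that a1)
  have upper: "poly_quad \<xi> Pb \<pi> x \<le> a2 * (norm x)\<^sup>2" if "\<pi> \<in> PP" for \<pi> x
  proof -
    \<comment> \<open>The vertex bound survives averaging; Cauchy-Schwarz then turns it into a bound
      on the form.\<close>
    have "norm (\<Sum>i\<in>UNIV. \<xi> i \<pi> *\<^sub>R (Pb i *v x)) \<le> a2 * norm x"
      by (intro norm_weighted_sum_le nonneg sum1 that a2)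
    then have "norm x * norm (\<Sum>i\<in>UNIV. \<xi> i \<pi> *\<^sub>R (Pb i *v x)) \<le> norm x * (a2 * norm x)"
      by (rule mult_left_mono) simp
    then show ?thesis
      using norm_cauchy_schwarz[of x "\<Sum>i\<in>UNIV. \<xi> i \<pi> *\<^sub>R (Pb i *v x)"]
      by (simp add: poly_quad_def weighted_sum_mult_vec power2_eq_square ac_simps)
  qed
  have decrease: "poly_quad \<xi> Pb (p (k + 1)) (F k p *v u) \<le> poly_quad \<xi> Pb (p k) u - c * (norm u)\<^sup>2"
    if p: "p \<in> param_seqs PP" for k p u
  proof -
    have pk: "p k \<in> PP" for k
      using p by (simp add: param_seqs_def)
    let ?P = "\<Sum>j\<in>UNIV. \<xi> j (p (k + 1)) *\<^sub>R Pb j"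
    define w where "w = - (F k p *v u)"
    have "c * (norm u)\<^sup>2 \<le> (\<Sum>i\<in>UNIV. \<xi> i (p k) * (u \<bullet> (Pb i *v u)
        + 2 * (w \<bullet> (?P *v (M i k p *v u))) + poly_quad \<xi> Pb (p (k + 1)) w))"
      by (intro weighted_sum_ge nonneg sum1 pk vertex p)
    also have "\<dots> = (\<Sum>i\<in>UNIV. \<xi> i (p k) * (u \<bullet> (Pb i *v u)))
        + 2 * (\<Sum>i\<in>UNIV. \<xi> i (p k) * (w \<bullet> (?P *v (M i k p *v u))))
        + (\<Sum>i\<in>UNIV. \<xi> i (p k)) * poly_quad \<xi> Pb (p (k + 1)) w"
      by (simp add: distrib_left sum.distrib sum_distrib_left sum_distrib_right ac_simps)
    also have "(\<Sum>i\<in>UNIV. \<xi> i (p k) * (w \<bullet> (?P *v (M i k p *v u)))) = w \<bullet> (?P *v (F k p *v u))"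
      unfolding F[OF p] weighted_sum_mult_vec[of _ "\<lambda>i. M i k p"] mult_vec_weighted_sum
      by (simp add: inner_sum_right)
    also have "(\<Sum>i\<in>UNIV. \<xi> i (p k) * (u \<bullet> (Pb i *v u))) = poly_quad \<xi> Pb (p k) u"
      by (simp add: quad)
    \<comment> \<open>For this \<open>w\<close> the cross term is minus twice the value of the form
      at \<open>F k p *v u\<close>, and the last term is plus that value, so one negative copy
      remains.\<close>
    finally show ?thesis
      by (simp add: w_def sum1[OF pk] poly_quad_def vec.neg)
  qed
  have "\<forall>i. symmetric_mat (Pb i)"
    using Pb by (simp add: pos_def_def)
  then show ?thesis
    unfolding poly_QLF_def
    by (intro conjI exI[of _ Pb] exI[of _ a1] exI[of _ a2] exI[of _ c])
      (auto simp: a1(1) a2(1) \<open>c > 0\<close> intro: lower upper decrease[simplified])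
qed

section \<open>Closed-loop systems and the gain with identity matrices\<close>

text \<open>The Lyapunov conditions see the transition map only on admissible sequences. This allows
  gains to be exchanged that agree there because the weights sum to 1.\<close>

lemma poly_QLF_cong:
  assumes "\<And>k p. p \<in> param_seqs PP \<Longrightarrow> F k p = G k p"
  shows "poly_QLF PP \<xi> F V \<longleftrightarrow> poly_QLF PP \<xi> G V"
  using assms by (auto simp: poly_QLF_def)

text \<open>Plant and gain carry the same weights at time \<open>k\<close>, so their sum does too.
  As \<open>k\<close> and \<open>p\<close> are fixed, \<open>L i\<close> may also depend on
  \<open>p (k + 1)\<close>.\<close>

lemma polytopic_closed_loop:
  assumes "polytopic PP A \<xi> Av" and "p \<in> param_seqs PP"
    and "K k p = (\<Sum>i\<in>UNIV. \<xi> i (p k) *\<^sub>R L i)"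
  shows "closed_loop A B K k p = (\<Sum>i\<in>UNIV. \<xi> i (p k) *\<^sub>R (Av i + B ** L i))"
proof -
  have "p k \<in> PP"
    using assms(2) by (simp add: param_seqs_def)
  then have "A (p k) = (\<Sum>i\<in>UNIV. \<xi> i (p k) *\<^sub>R Av i)"
    using assms(1) by (simp add: polytopic_def)
  then have "closed_loop A B K k p *v x = (\<Sum>i\<in>UNIV. \<xi> i (p k) *\<^sub>R (Av i + B ** L i)) *v x" for x
    by (simp add: closed_loop_def assms(3) matrix_vector_mult_add_rdistrib weighted_sum_mult_vec
        mult_vec_weighted_sum scaleR_add_right sum.distrib flip: matrix_vector_mul_assoc)
  then show ?thesis
    by (simp add: matrix_eq)
qed

text \<open>The averaged identities are the identity because the weights sum to 1, so the inverse
  disappears; the sum over \<open>j\<close> then removes the second weight, and both gains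
  coincide.\<close>

lemma stabilizable_gain_X_if_gain_poly:
  assumes poly: "polytopic PP A \<xi> Av" and stab: "stabilizable_gain_poly PP \<xi> A B Kb"
  shows "stabilizable_gain_X PP \<xi> A B (\<lambda>i j. Kb i) (\<lambda>i j. mat 1)"
proof -
  have inv_one: "matrix_inv (mat 1 :: real^'n^'n) = mat 1"
    using matrix_inv_mult(1)[of "mat 1 :: real^'n^'n"] by (auto simp: invertible_def)
  have sum1: "(\<Sum>m\<in>UNIV. \<xi> m (p k)) = 1" if "p \<in> param_seqs PP" for p k
    using poly that by (auto simp: polytopic_def param_seqs_def)
  have one: "(\<Sum>m\<in>UNIV. \<xi> m (p k) *\<^sub>R (mat 1 :: real^'n^'n)) = mat 1"
    if "p \<in> param_seqs PP" for p k
    using sum1[OF that] by (simp flip: scaleR_sum_left)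
  have "gain_X \<xi> (\<lambda>i j. Kb i) (\<lambda>i j. mat 1) k p = gain_poly \<xi> Kb k p"
    if "p \<in> param_seqs PP" for k p
    using sum1[OF that, of "k + 1"]
    by (simp add: gain_X_def gain_poly_def one[OF that, of "k + 1", simplified] inv_one
        flip: scaleR_sum_left sum_distrib_left)
  then have "poly_QLF PP \<xi> (closed_loop A B (gain_X \<xi> (\<lambda>i j. Kb i) (\<lambda>i j. mat 1))) V \<longleftrightarrow>
      poly_QLF PP \<xi> (closed_loop A B (gain_poly \<xi> Kb)) V" for V
    by (intro poly_QLF_cong) (simp add: closed_loop_def)
  moreover have "gain_X_well_defined PP \<xi> (\<lambda>i j. mat 1)"
    unfolding gain_X_well_defined_def
    by (auto simp: one[of _ "Suc _"] invertible_def)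
  ultimately show ?thesis
    using stab
    by (simp add: stabilizable_gain_X_def stabilizable_gain_poly_def poly_Q_stabilizable_with_def
        poly_QS_def)
qed

section \<open>The LMI without slack matrices\<close>

text \<open>The congruence that removes the inverses. Since the \<open>Pb i\<close> are invertible,
  it serves in both directions: from the LMI to the Lyapunov decrease and back.\<close>

lemma inner_LMI_poly_block:
  fixes Pb :: "'m \<Rightarrow> real^'x^'x"
  assumes "\<And>i. symmetric_mat (Pb i)" and "\<And>i. invertible (Pb i)"
  defines "S \<equiv> \<lambda>i. matrix_inv (Pb i)"
  shows "join (Pb i *v u) (Pb j *v w) \<bullet>
      (sym_block2 (S i) (Av i ** S i + B ** (Kb i ** S i)) (S j) *v join (Pb i *v u) (Pb j *v w)) =
    u \<bullet> (Pb i *v u) + 2 * (w \<bullet> (Pb j *v ((Av i + B ** Kb i) *v u))) + w \<bullet> (Pb j *v w)"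
  unfolding inner_sym_block2 S_def
  by (simp add: matrix_vector_mult_add_rdistrib symmetric_mat_inner[OF assms(1)]
      matrix_inv_mult_vec[OF assms(2)] flip: matrix_vector_mul_assoc)

lemma poly_QLF_if_LMI_poly:
  fixes Pb :: "'m::finite \<Rightarrow> real^'x^'x"
  assumes poly: "polytopic PP A \<xi> Av" and LMI: "LMI_poly Av B Pb Kb"
  shows "poly_QLF PP \<xi> (closed_loop A B (gain_poly \<xi> Kb)) (poly_quad \<xi> Pb)"
proof -
  define S where "S i = matrix_inv (Pb i)" for i
  \<comment> \<open>Indexing by pairs lets one constant serve all LMIs at once.\<close>
  define Q where "Q = (\<lambda>(i, j). sym_block2 (S i) (Av i ** S i + B ** (Kb i ** S i)) (S j))"
  have sym: "\<And>i. symmetric_mat (Pb i)" and inv: "\<And>i. invertible (Pb i)"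
    and Q_pos: "\<And>ij. pos_def (Q ij)"
    using LMI by (auto simp: LMI_poly_def Let_def Q_def S_def)
  have Pb: "pos_def (Pb i)" for i
  proof (rule pos_def_if_inv[OF sym inv])
    fix x :: "real^'x"
    assume "x \<noteq> 0"
    \<comment> \<open>A zero second block isolates the diagonal block \<open>S i\<close>.\<close>
    then have "join x 0 \<bullet> (Q (i, i) *v join x 0) > 0"
      using Q_pos[of "(i, i)"] by (simp add: pos_def_def join_eq_0_iff)
    then show "x \<bullet> (matrix_inv (Pb i) *v x) > 0"
      by (simp add: Q_def inner_sym_block2 S_def)
  qed
  obtain a where a: "a > 0" "\<And>i x. a * (norm x)\<^sup>2 \<le> x \<bullet> (Pb i *v x)"
    by (rule pos_def_uniformly_bounded_below[of Pb, OF Pb], rule that)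
  obtain c where c: "c > 0" "\<And>ij z. c * (norm z)\<^sup>2 \<le> z \<bullet> (Q ij *v z)"
    by (rule pos_def_uniformly_bounded_below[of Q, OF Q_pos], rule that)
  \<comment> \<open>The LMI margin is measured in \<open>Pb i *v u\<close>; this converts it to one
    in \<open>u\<close> and produces the factor \<open>a\<^sup>2\<close> below.\<close>
  have norm_Pb: "a * norm u \<le> norm (Pb i *v u)" for i u
  proof (cases "u = 0")
    case False
    have "a * (norm u)\<^sup>2 \<le> norm u * norm (Pb i *v u)"
      using a(2)[of u i] norm_cauchy_schwarz[of u "Pb i *v u"] by linarith
    then show ?thesis
      using False by (simp add: power2_eq_square ac_simps)
  qed simp
  have pair: "c * a\<^sup>2 * (norm u)\<^sup>2 \<le>
      u \<bullet> (Pb i *v u) + 2 * (w \<bullet> (Pb j *v ((Av i + B ** Kb i) *v u))) + w \<bullet> (Pb j *v w)"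
    for i j u w
  proof -
    have "(a * norm u)\<^sup>2 \<le> (norm (Pb i *v u))\<^sup>2"
      using norm_Pb a(1) by (intro power_mono) auto
    also have "\<dots> \<le> (norm (join (Pb i *v u) (Pb j *v w)))\<^sup>2"
      by (simp add: norm_join)
    finally have "c * (a * norm u)\<^sup>2 \<le> c * (norm (join (Pb i *v u) (Pb j *v w)))\<^sup>2"
      using c(1) by simp
    also note c(2)[of _ "(i, j)", unfolded Q_def prod.case]
    also note inner_LMI_poly_block[of Pb i u j w Av B Kb, OF sym inv, folded S_def]
    finally show ?thesis
      by (simp add: power_mult_distrib ac_simps)
  qed
  show ?thesis
  proof (rule poly_QLF_if_vertex_ineqs[OF poly Pb])
    show "c * a\<^sup>2 > 0"
      using a c by simp
    show "closed_loop A B (gain_poly \<xi> Kb) k p = (\<Sum>i\<in>UNIV. \<xi> i (p k) *\<^sub>R (Av i + B ** Kb i))"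
      if "p \<in> param_seqs PP" for k p
      by (rule polytopic_closed_loop[OF poly that]) (simp add: gain_poly_def)
    fix k p i u w
    assume "p \<in> param_seqs PP"
    then have "p (k + 1) \<in> PP"
      by (simp add: param_seqs_def)
    \<comment> \<open>For fixed \<open>i\<close>, \<open>u\<close> and \<open>w\<close> only
      \<open>Pb j\<close> varies with \<open>j\<close>, and the inequality is affine in it, so it
      can be averaged with the weights at time \<open>k + 1\<close>.\<close>
    then have "c * a\<^sup>2 * (norm u)\<^sup>2 \<le> (\<Sum>j\<in>UNIV. \<xi> j (p (k + 1)) *
        (u \<bullet> (Pb i *v u) + 2 * (w \<bullet> (Pb j *v ((Av i + B ** Kb i) *v u))) + w \<bullet> (Pb j *v w)))"
      using poly by (intro weighted_sum_ge pair) (auto simp: polytopic_def)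
    also have "\<dots> = (\<Sum>j\<in>UNIV. \<xi> j (p (k + 1))) * (u \<bullet> (Pb i *v u))
        + 2 * (\<Sum>j\<in>UNIV. \<xi> j (p (k + 1)) * (w \<bullet> (Pb j *v ((Av i + B ** Kb i) *v u))))
        + (\<Sum>j\<in>UNIV. \<xi> j (p (k + 1)) * (w \<bullet> (Pb j *v w)))"
      by (simp add: distrib_left sum.distrib sum_distrib_left sum_distrib_right ac_simps)
    finally show "c * a\<^sup>2 * (norm u)\<^sup>2 \<le> u \<bullet> (Pb i *v u)
        + 2 * (w \<bullet> ((\<Sum>j\<in>UNIV. \<xi> j (p (k + 1)) *\<^sub>R Pb j) *v ((Av i + B ** Kb i) *v u)))
        + poly_quad \<xi> Pb (p (k + 1)) w"
      using poly \<open>p (k + 1) \<in> PP\<close>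
      by (simp add: polytopic_def poly_quad_def weighted_sum_mult_vec inner_sum_right)
  qed
qed

section \<open>The LMI with slack matrices \<open>X\<close> and \<open>Z\<close>\<close>

context
  fixes Av :: "'m::finite \<Rightarrow> real^'x^'x" and B :: "real^'u^'x" and Pb :: "'m \<Rightarrow> real^'x^'x"
    and X :: "'m \<Rightarrow> 'm \<Rightarrow> real^'x^'x" and Kb :: "'m \<Rightarrow> 'm \<Rightarrow> real^'x^'u" and Z :: "'m \<Rightarrow> real^'x^'x"
  assumes LMI: "LMI_X Av B Pb X Kb Z"
begin

lemma LMI_X_sym: "symmetric_mat (Pb i)" and LMI_X_inv: "invertible (Pb i)"
  using LMI by (simp_all add: LMI_X_def)

lemma LMI_X_form_bounded_below:
  obtains (bound) c where "c > 0" and "\<And>i j x y z. c * ((norm x)\<^sup>2 + (norm y)\<^sup>2 + (norm z)\<^sup>2) \<le>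
    2 * (x \<bullet> (X i j *v x)) - x \<bullet> (matrix_inv (Pb i) *v x)
      + 2 * (y \<bullet> ((Av i + B ** Kb i j) *v (X i j *v x)))
      + 2 * (y \<bullet> (Z i *v y)) + 2 * (z \<bullet> (Z i *v y)) + z \<bullet> (matrix_inv (Pb j) *v z)"
proof -
  define Q where "Q = (\<lambda>(i, j). sym_block3 (X i j + transpose (X i j) - matrix_inv (Pb i))
    (Av i ** X i j + B ** (Kb i j ** X i j)) (Z i + transpose (Z i)) 0 (Z i) (matrix_inv (Pb j)))"
  have Q_pos: "pos_def (Q ij)" for ij
    using LMI by (cases ij) (simp add: LMI_X_def Let_def Q_def)
  obtain c where c: "c > 0" "\<And>ij z. c * (norm z)\<^sup>2 \<le> z \<bullet> (Q ij *v z)"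
    by (rule pos_def_uniformly_bounded_below[of Q, OF Q_pos], rule that)
  \<comment> \<open>A matrix and its transpose have the same quadratic form, so a block
    \<open>M + transpose M\<close> contributes twice the form of \<open>M\<close>.\<close>
  have transp: "x \<bullet> (x v* M) = x \<bullet> (M *v x)" for M :: "real^'x^'x" and x
    by (metis dot_lmul_matrix inner_commute)
  have factor: "Av i ** X i j + B ** (Kb i j ** X i j) = (Av i + B ** Kb i j) ** X i j" for i j
    by (simp add: matrix_eq matrix_vector_mult_add_rdistrib flip: matrix_vector_mul_assoc)
  show thesis
  proof (rule that[OF c(1)])
    fix i j and x y z :: "real^'x"
    let ?z = "join x (join y z)"
    have "c * ((norm x)\<^sup>2 + (norm y)\<^sup>2 + (norm z)\<^sup>2) = c * (norm ?z)\<^sup>2"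
      by (simp add: norm_join add.assoc)
    also have "\<dots> \<le> ?z \<bullet> (Q (i, j) *v ?z)"
      by (rule c(2))
    also have "\<dots> = 2 * (x \<bullet> (X i j *v x)) - x \<bullet> (matrix_inv (Pb i) *v x)
      + 2 * (y \<bullet> ((Av i + B ** Kb i j) *v (X i j *v x)))
      + 2 * (y \<bullet> (Z i *v y)) + 2 * (z \<bullet> (Z i *v y)) + z \<bullet> (matrix_inv (Pb j) *v z)"
      unfolding Q_def prod.case inner_sym_block3 factor
        matrix_vector_mult_add_rdistrib[of _ "transpose _"] matrix_vector_mult_diff_rdistrib
      by (simp add: inner_add_right inner_diff_right transp matrix_vector_mul_assoc)
    finally show "c * ((norm x)\<^sup>2 + (norm y)\<^sup>2 + (norm z)\<^sup>2) \<le>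
      2 * (x \<bullet> (X i j *v x)) - x \<bullet> (matrix_inv (Pb i) *v x)
      + 2 * (y \<bullet> ((Av i + B ** Kb i j) *v (X i j *v x)))
      + 2 * (y \<bullet> (Z i *v y)) + 2 * (z \<bullet> (Z i *v y)) + z \<bullet> (matrix_inv (Pb j) *v z)" .
  qed
qed

lemma LMI_X_pos_def: "pos_def (Pb i)"
proof (cases rule: LMI_X_form_bounded_below)
  case (bound c)
  show ?thesis
  proof (rule pos_def_if_inv[OF LMI_X_sym LMI_X_inv])
    fix z :: "real^'x"
    assume "z \<noteq> 0"
    then have "0 < c * (norm z)\<^sup>2"
      using bound(1) by simp
    also have "\<dots> \<le> z \<bullet> (matrix_inv (Pb i) *v z)"
      \<comment> \<open>Zero first and second blocks leave only the last diagonal block, taken at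
        \<open>j = i\<close>.\<close>
      using bound(2)[of 0 0 z i i] by simp
    finally show "z \<bullet> (matrix_inv (Pb i) *v z) > 0" .
  qed
qed

text \<open>With \<open>y = P *v w\<close> and \<open>z = - Pb j *v w\<close>, the terms containing \<open>Z i\<close> cancel after averaging
  over \<open>j\<close>.\<close>

lemma LMI_X_averaged:
  obtains (bound) c where "c > 0" and "\<And>b i x w P. \<lbrakk>\<And>j. b j \<ge> 0; (\<Sum>j\<in>UNIV. b j) = 1;
      P = (\<Sum>j\<in>UNIV. b j *\<^sub>R Pb j)\<rbrakk> \<Longrightarrow>
    c * (norm x)\<^sup>2 \<le> 2 * (x \<bullet> ((\<Sum>j\<in>UNIV. b j *\<^sub>R X i j) *v x)) - x \<bullet> (matrix_inv (Pb i) *v x)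
      + 2 * (w \<bullet> (P *v (\<Sum>j\<in>UNIV. b j *\<^sub>R ((Av i + B ** Kb i j) *v (X i j *v x)))))
      + w \<bullet> (P *v w)"
proof (cases rule: LMI_X_form_bounded_below)
  case (bound c)
  show thesis
  proof (rule that[OF bound(1)])
    fix b :: "'m \<Rightarrow> real" and i x w P
    assume b: "\<And>j. b j \<ge> 0" "(\<Sum>j\<in>UNIV. b j) = 1" and P: "P = (\<Sum>j\<in>UNIV. b j *\<^sub>R Pb j)"
    define y where "y = P *v w"
    define v where "v j = (Av i + B ** Kb i j) *v (X i j *v x)" for j
    have P_sym: "symmetric_mat P"
      unfolding P by (intro symmetric_mat_weighted_sum LMI_X_sym)
    have "c * (norm x)\<^sup>2 \<le> 2 * (x \<bullet> (X i j *v x)) - x \<bullet> (matrix_inv (Pb i) *v x)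
      + 2 * (y \<bullet> v j) + 2 * (y \<bullet> (Z i *v y)) - 2 * (w \<bullet> (Pb j *v (Z i *v y)))
      + w \<bullet> (Pb j *v w)" (is "_ \<le> ?f j") for j
    proof -
      have "c * (norm x)\<^sup>2 \<le> c * ((norm x)\<^sup>2 + (norm y)\<^sup>2 + (norm (- (Pb j *v w)))\<^sup>2)"
        using bound(1) by simp
      also note bound(2)[of x y _ i j]
      finally show ?thesis
        by (simp add: v_def vec.neg matrix_inv_mult_vec[OF LMI_X_inv]
            symmetric_mat_inner[OF LMI_X_sym])
    qed
    with b have "c * (norm x)\<^sup>2 \<le> (\<Sum>j\<in>UNIV. b j * ?f j)"
      by (intro weighted_sum_ge)
    also have "\<dots> = 2 * (\<Sum>j\<in>UNIV. b j * (x \<bullet> (X i j *v x)))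
        - (\<Sum>j\<in>UNIV. b j) * (x \<bullet> (matrix_inv (Pb i) *v x))
        + 2 * (\<Sum>j\<in>UNIV. b j * (y \<bullet> v j)) + (\<Sum>j\<in>UNIV. b j) * (2 * (y \<bullet> (Z i *v y)))
        - 2 * (\<Sum>j\<in>UNIV. b j * (w \<bullet> (Pb j *v (Z i *v y))))
        + (\<Sum>j\<in>UNIV. b j * (w \<bullet> (Pb j *v w)))"
      by (simp add: distrib_left right_diff_distrib sum.distrib sum_subtractf sum_distrib_left
          sum_distrib_right ac_simps)
    also have "\<dots> = 2 * (x \<bullet> ((\<Sum>j\<in>UNIV. b j *\<^sub>R X i j) *v x)) - x \<bullet> (matrix_inv (Pb i) *v x)
        + 2 * (y \<bullet> (\<Sum>j\<in>UNIV. b j *\<^sub>R v j)) + 2 * (y \<bullet> (Z i *v y))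
        - 2 * (w \<bullet> (P *v (Z i *v y))) + w \<bullet> (P *v w)"
      by (simp add: b(2) P weighted_sum_mult_vec inner_sum_right)
    \<comment> \<open>Since \<open>Z i\<close> and \<open>y\<close> do not depend on
      \<open>j\<close>, averaging has replaced \<open>Pb j\<close> by \<open>P\<close>; symmetry of
      \<open>P\<close> now gives
      \<open>w \<bullet> (P *v (Z i *v y)) = y \<bullet> (Z i *v y)\<close>, and these terms
      cancel.\<close>
    finally show "c * (norm x)\<^sup>2 \<le> 2 * (x \<bullet> ((\<Sum>j\<in>UNIV. b j *\<^sub>R X i j) *v x))
      - x \<bullet> (matrix_inv (Pb i) *v x)
      + 2 * (w \<bullet> (P *v (\<Sum>j\<in>UNIV. b j *\<^sub>R ((Av i + B ** Kb i j) *v (X i j *v x)))))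
      + w \<bullet> (P *v w)"
      by (simp add: y_def v_def symmetric_mat_inner[OF P_sym])
  qed
qed

text \<open>On a kernel vector \<open>x\<close>, the averaged inequality with \<open>w = 0\<close>
  bounds \<open>c * (norm x)\<^sup>2\<close> by minus the form of the inverse of
  \<open>Pb i\<close>, which is nonpositive.\<close>

lemma LMI_X_invertible:
  assumes b: "\<And>j. b j \<ge> 0" "(\<Sum>j\<in>UNIV. b j) = 1"
  shows "invertible (\<Sum>j\<in>UNIV. b j *\<^sub>R X i j)"
  unfolding invertible_real_mat_iff
proof (cases rule: LMI_X_averaged)
  case (bound c)
  show "\<forall>x. (\<Sum>j\<in>UNIV. b j *\<^sub>R X i j) *v x = 0 \<longrightarrow> x = 0"
  proof (intro allI impI)
    fix x
    assume x: "(\<Sum>j\<in>UNIV. b j *\<^sub>R X i j) *v x = 0"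
    let ?Sx = "matrix_inv (Pb i) *v x"
    have "?Sx \<bullet> (Pb i *v ?Sx) \<ge> 0"
      using LMI_X_pos_def[of i] by (cases "?Sx = 0") (auto simp: pos_def_def less_imp_le)
    then have "x \<bullet> ?Sx \<ge> 0"
      by (simp add: matrix_inv_mult_vec[OF LMI_X_inv] inner_commute)
    with bound(2)[OF b refl, of x i 0] x have "c * (norm x)\<^sup>2 \<le> 0"
      by simp
    with bound(1) show "x = 0"
      by (simp add: mult_le_0_iff)
  qed
qed

lemma poly_QLF_if_LMI_X:
  fixes \<xi> :: "'m \<Rightarrow> real^'p \<Rightarrow> real"
  assumes poly: "polytopic PP A \<xi> Av"
  shows "poly_QLF PP \<xi> (closed_loop A B (gain_X \<xi> Kb X)) (poly_quad \<xi> Pb)"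
proof (cases rule: LMI_X_averaged)
  case (bound c)
  obtain C where C: "C > 0" "\<And>ij x. norm (X (fst ij) (snd ij) *v x) \<le> C * norm x"
    by (rule matrix_vector_mult_bounded[of "\<lambda>ij. X (fst ij) (snd ij)"], rule that)
  define Xi where "Xi i k p = (\<Sum>m\<in>UNIV. \<xi> m (p (k + 1)) *\<^sub>R X i m)" for i k and p :: "nat \<Rightarrow> real^'p"
  \<comment> \<open>The share of the gain that carries the weight
    \<open>\<xi> i (p k)\<close>.\<close>
  define L where "L i k p = (\<Sum>j\<in>UNIV. \<xi> j (p (k + 1)) *\<^sub>R (Kb i j ** X i j ** matrix_inv (Xi i k p)))"
    for i k p
  show ?thesis
  proof (rule poly_QLF_if_vertex_ineqs[OF poly LMI_X_pos_def])
    \<comment> \<open>The margin is known in terms of \<open>x\<close>; as \<open>u\<close> is an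
      average of the \<open>X i j *v x\<close>, its norm is at most
      \<open>C * norm x\<close>.\<close>
    show "c / C\<^sup>2 > 0"
      using bound(1) C(1) by simp
    show "closed_loop A B (gain_X \<xi> Kb X) k p = (\<Sum>i\<in>UNIV. \<xi> i (p k) *\<^sub>R (Av i + B ** L i k p))"
      if "p \<in> param_seqs PP" for k p
      by (rule polytopic_closed_loop[OF poly that])
        (simp add: gain_X_def L_def Xi_def scaleR_sum_right)
    fix k p i u w
    assume "p \<in> param_seqs PP"
    then have "p (k + 1) \<in> PP"
      by (simp add: param_seqs_def)
    define b where "b j = \<xi> j (p (k + 1))" for j
    have b: "\<And>j. b j \<ge> 0" "(\<Sum>j\<in>UNIV. b j) = 1"
      using poly \<open>p (k + 1) \<in> PP\<close> by (auto simp: polytopic_def b_def)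
    define P where "P = (\<Sum>j\<in>UNIV. b j *\<^sub>R Pb j)"
    have Xi: "Xi i k p = (\<Sum>j\<in>UNIV. b j *\<^sub>R X i j)"
      by (simp add: Xi_def b_def)
    define x where "x = matrix_inv (Xi i k p) *v u"
    have u: "Xi i k p *v x = u"
      unfolding x_def Xi using LMI_X_invertible[OF b] by (rule matrix_inv_mult_vec)
    have "norm u \<le> C * norm x"
      unfolding u[symmetric] Xi weighted_sum_mult_vec
      using C(2)[of "(i, _)"] by (intro norm_weighted_sum_le b) auto
    then have "(norm u)\<^sup>2 \<le> (C * norm x)\<^sup>2"
      by (intro power_mono) auto
    then have "c / C\<^sup>2 * (norm u)\<^sup>2 \<le> c / C\<^sup>2 * (C * norm x)\<^sup>2"
      using bound(1) by (intro mult_left_mono) auto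
    also have "\<dots> = c * (norm x)\<^sup>2"
      using C(1) by (simp add: power_mult_distrib)
    also have "\<dots> \<le> 2 * (x \<bullet> u) - x \<bullet> (matrix_inv (Pb i) *v x)
      + 2 * (w \<bullet> (P *v (\<Sum>j\<in>UNIV. b j *\<^sub>R ((Av i + B ** Kb i j) *v (X i j *v x)))))
      + w \<bullet> (P *v w)"
      using bound(2)[OF b P_def, of x i w] by (simp add: u flip: Xi)
    \<comment> \<open>In the part with \<open>Av i\<close> the average of the
      \<open>X i j *v x\<close> is \<open>u\<close>; in the part with \<open>B\<close> the inverse
      inside \<open>L\<close> maps \<open>u\<close> to \<open>x\<close>.\<close>
    also have "(\<Sum>j\<in>UNIV. b j *\<^sub>R ((Av i + B ** Kb i j) *v (X i j *v x))) = (Av i + B ** L i k p) *v u"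
    proof -
      have "(\<Sum>j\<in>UNIV. b j *\<^sub>R ((Av i + B ** Kb i j) *v (X i j *v x))) =
          Av i *v (Xi i k p *v x) + B *v (\<Sum>j\<in>UNIV. b j *\<^sub>R (Kb i j *v (X i j *v x)))"
        unfolding Xi
        by (simp add: matrix_vector_mult_add_rdistrib weighted_sum_mult_vec mult_vec_weighted_sum
            scaleR_add_right sum.distrib flip: matrix_vector_mul_assoc)
      also have "(\<Sum>j\<in>UNIV. b j *\<^sub>R (Kb i j *v (X i j *v x))) = L i k p *v u"
        unfolding x_def L_def
        by (simp add: b_def weighted_sum_mult_vec flip: matrix_vector_mul_assoc)
      finally show ?thesis
        by (simp add: u matrix_vector_mult_add_rdistrib flip: matrix_vector_mul_assoc)
    qed
    \<comment> \<open>Completing the square: the form of \<open>Pb i\<close> at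
      \<open>u - matrix_inv (Pb i) *v x\<close> is nonnegative.\<close>
    also have "2 * (x \<bullet> u) - x \<bullet> (matrix_inv (Pb i) *v x) \<le> u \<bullet> (Pb i *v u)"
    proof -
      let ?d = "u - matrix_inv (Pb i) *v x"
      have "0 \<le> ?d \<bullet> (Pb i *v ?d)"
        using LMI_X_pos_def[of i] by (cases "?d = 0") (auto simp: pos_def_def less_imp_le)
      also have "Pb i *v ?d = Pb i *v u - x"
        by (simp add: matrix_vector_mult_diff_distrib matrix_inv_mult_vec[OF LMI_X_inv])
      also have "?d \<bullet> (Pb i *v u - x) = u \<bullet> (Pb i *v u) - 2 * (x \<bullet> u) + x \<bullet> (matrix_inv (Pb i) *v x)"
        using symmetric_mat_inner[OF LMI_X_sym, of i "matrix_inv (Pb i) *v x" u]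
        by (simp add: inner_diff_left inner_diff_right matrix_inv_mult_vec[OF LMI_X_inv] inner_commute)
      finally show ?thesis
        by simp
    qed
    finally show "c / C\<^sup>2 * (norm u)\<^sup>2 \<le> u \<bullet> (Pb i *v u)
        + 2 * (w \<bullet> ((\<Sum>j\<in>UNIV. \<xi> j (p (k + 1)) *\<^sub>R Pb j) *v ((Av i + B ** L i k p) *v u)))
        + poly_quad \<xi> Pb (p (k + 1)) w"
      by (simp add: poly_quad_def P_def b_def)
  qed
qed

end

section \<open>Necessity of the LMI for strictly polytopic systems\<close>

lemma LMI_poly_if_stabilizable:
  fixes Av :: "'m::finite \<Rightarrow> real^'x^'x"
  assumes strict: "strictly_polytopic PP A \<xi> Av" and stab: "stabilizable_gain_poly PP \<xi> A B Kb"
  shows "\<exists>Pb. LMI_poly Av B Pb Kb"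
proof -
  obtain V where "poly_QLF PP \<xi> (closed_loop A B (gain_poly \<xi> Kb)) V"
    using stab
    by (auto simp: stabilizable_gain_poly_def poly_Q_stabilizable_with_def poly_QS_def)
  then obtain Pb a1 a3 where sym: "\<And>i. symmetric_mat (Pb i)"
    and V: "\<And>\<pi> x. \<pi> \<in> PP \<Longrightarrow> V \<pi> x = poly_quad \<xi> Pb \<pi> x"
    and "a1 > 0" "a3 > 0" and lower: "\<And>\<pi> x. \<pi> \<in> PP \<Longrightarrow> a1 * (norm x)\<^sup>2 \<le> V \<pi> x"
    and decrease: "\<And>k p x. p \<in> param_seqs PP \<Longrightarrow>
      V (p (k + 1)) (closed_loop A B (gain_poly \<xi> Kb) k p *v x) \<le> V (p k) x - a3 * (norm x)\<^sup>2"
    unfolding poly_QLF_def by blast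
  have poly: "polytopic PP A \<xi> Av"
    using strict by (simp add: strictly_polytopic_def)
  have "\<exists>\<pi>\<in>PP. \<forall>j. \<xi> j \<pi> = (if j = i then 1 else 0)" for i
  proof -
    obtain \<pi> where "\<pi> \<in> PP" and \<pi>: "axis i 1 = (\<chi> j. \<xi> j \<pi>)"
      using strict by (auto simp: strictly_polytopic_def)
    have "\<xi> j \<pi> = axis i 1 $ j" for j
      unfolding \<pi> by simp
    then have "\<forall>j. \<xi> j \<pi> = (if j = i then 1 else 0)"
      by (simp add: axis_def)
    with \<open>\<pi> \<in> PP\<close> show ?thesis
      by blast
  qed
  \<comment> \<open>\<open>e i\<close> is an admissible parameter at which all weight lies on vertex
    \<open>i\<close>.\<close>
  then obtain e where e: "\<And>i. e i \<in> PP" "\<And>i j. \<xi> j (e i) = (if j = i then 1 else 0)"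
    by metis
  have at_vertex: "(\<Sum>j\<in>UNIV. \<xi> j (e i) *\<^sub>R M j) = M i" for i and M :: "_ \<Rightarrow> real^'n^'k"
    by (simp add: e(2) if_distrib[of "\<lambda>a. a *\<^sub>R _"] cong: if_cong)
  have V_e: "V (e i) x = x \<bullet> (Pb i *v x)" for i x
    by (simp add: V[OF e(1)] poly_quad_def at_vertex)
  have pos: "pos_def (Pb i)" for i
    unfolding pos_def_def
  proof (intro conjI allI impI sym)
    fix x :: "real^'x"
    assume "x \<noteq> 0"
    then have "0 < a1 * (norm x)\<^sup>2"
      using \<open>a1 > 0\<close> by simp
    also have "\<dots> \<le> x \<bullet> (Pb i *v x)"
      using lower[OF e(1)] by (simp add: V_e)
    finally show "x \<bullet> (Pb i *v x) > 0" .
  qed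
  then have inv: "\<And>i. invertible (Pb i)"
    by (rule pos_def_invertible)
  have vertex_decrease: "((Av i + B ** Kb i) *v u) \<bullet> (Pb j *v ((Av i + B ** Kb i) *v u))
      \<le> u \<bullet> (Pb i *v u) - a3 * (norm u)\<^sup>2" for i j u
  proof -
    \<comment> \<open>One step from \<open>e i\<close> to \<open>e j\<close> suffices: the decrease
      at time 0 then couples an arbitrary pair of vertices.\<close>
    define p where "p k = (if k = 0 then e i else e j)" for k :: nat
    have p: "p \<in> param_seqs PP"
      by (simp add: param_seqs_def p_def e(1))
    have "closed_loop A B (gain_poly \<xi> Kb) 0 p = (\<Sum>i\<in>UNIV. \<xi> i (p 0) *\<^sub>R (Av i + B ** Kb i))"
      by (rule polytopic_closed_loop[OF poly p]) (simp add: gain_poly_def)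
    then have "closed_loop A B (gain_poly \<xi> Kb) 0 p = Av i + B ** Kb i"
      by (simp add: p_def at_vertex)
    then show ?thesis
      using decrease[OF p, of 0 u] by (simp add: p_def V_e)
  qed
  have "pos_def (sym_block2 (matrix_inv (Pb i))
      (Av i ** matrix_inv (Pb i) + B ** (Kb i ** matrix_inv (Pb i))) (matrix_inv (Pb j)))"
    (is "pos_def ?Q") for i j
    unfolding pos_def_def
  proof (intro conjI allI impI)
    show "symmetric_mat ?Q"
      by (intro symmetric_sym_block2 symmetric_mat_inv sym inv)
    fix z :: "real^('x + 'x)"
    assume "z \<noteq> 0"
    obtain x y where z: "z = join x y"
      by (rule join_eqE)
    define u where "u = matrix_inv (Pb i) *v x"
    define w where "w = matrix_inv (Pb j) *v y"
    have xy: "x = Pb i *v u" "y = Pb j *v w"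
      by (simp_all add: u_def w_def matrix_inv_mult_vec[OF inv])
    define v where "v = (Av i + B ** Kb i) *v u"
    have "z \<bullet> (?Q *v z) = u \<bullet> (Pb i *v u) + 2 * (w \<bullet> (Pb j *v v)) + w \<bullet> (Pb j *v w)"
      unfolding z xy v_def by (rule inner_LMI_poly_block[OF sym inv])
    \<comment> \<open>Completing the square in \<open>w\<close> separates the decrease along the
      vertex dynamics from a nonnegative rest.\<close>
    also have "\<dots> = (u \<bullet> (Pb i *v u) - v \<bullet> (Pb j *v v)) + (w + v) \<bullet> (Pb j *v (w + v))"
      using symmetric_mat_inner[OF sym, of j v w]
      by (simp add: matrix_vector_right_distrib inner_add_left inner_add_right inner_commute)
    also have "\<dots> > 0"
    proof -
      have ge: "(w + v) \<bullet> (Pb j *v (w + v)) \<ge> 0"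
        using pos[of j] by (cases "w + v = 0") (auto simp: pos_def_def less_imp_le)
      have dec: "v \<bullet> (Pb j *v v) \<le> u \<bullet> (Pb i *v u) - a3 * (norm u)\<^sup>2"
        unfolding v_def by (rule vertex_decrease)
      show ?thesis
      \<comment> \<open>For nonzero \<open>u\<close> the decrease is strict. Otherwise
        \<open>v\<close> vanishes and \<open>w\<close> does not, so the remaining form of
        \<open>Pb j\<close> is positive.\<close>
      proof (cases "u = 0")
        case True
        then have "w \<noteq> 0"
          using \<open>z \<noteq> 0\<close> by (auto simp: z xy join_eq_0_iff)
        then show ?thesis
          using True pos[of j] by (simp add: v_def pos_def_def)
      next
        case False
        then have "a3 * (norm u)\<^sup>2 > 0"
          using \<open>a3 > 0\<close> by simp
        with ge dec show ?thesis
          by linarith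
      qed
    qed
    finally show "z \<bullet> (?Q *v z) > 0" .
  qed
  then have "LMI_poly Av B Pb Kb"
    by (simp add: LMI_poly_def Let_def sym inv)
  then show ?thesis
    by blast
qed

theorem theorem4:
  fixes PP :: "(real^'p) set"
    and A :: "real^'p \<Rightarrow> real^'x^'x"
    and B :: "real^'u^'x"
    and \<xi> :: "'m::finite \<Rightarrow> real^'p \<Rightarrow> real"
    and Av :: "'m \<Rightarrow> real^'x^'x"
  assumes "compact PP"
    and "polytopic PP A \<xi> Av"
  shows "(\<forall>Kb. stabilizable_gain_poly PP \<xi> A B Kb \<longrightarrow>
            stabilizable_gain_X PP \<xi> A B (\<lambda>i j. Kb i) (\<lambda>i j. mat 1)) \<and>
         (\<forall>Pb Kb. LMI_poly Av B Pb Kb \<longrightarrow>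
            stabilizable_gain_poly PP \<xi> A B Kb \<and>
            poly_QLF PP \<xi> (closed_loop A B (gain_poly \<xi> Kb)) (poly_quad \<xi> Pb)) \<and>
         (\<forall>Pb X Kb Z. LMI_X Av B Pb X Kb Z \<longrightarrow>
            stabilizable_gain_X PP \<xi> A B Kb X \<and>
            poly_QLF PP \<xi> (closed_loop A B (gain_X \<xi> Kb X)) (poly_quad \<xi> Pb) \<and>
            (\<forall>i. \<forall>\<pi>\<in>PP. invertible (\<Sum>j\<in>UNIV. \<xi> j \<pi> *\<^sub>R X i j))) \<and>
         (strictly_polytopic PP A \<xi> Av \<longrightarrow>
            ((\<exists>Kb. stabilizable_gain_poly PP \<xi> A B Kb) \<longleftrightarrow> (\<exists>Pb Kb. LMI_poly Av B Pb Kb)))"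
proof (intro conjI allI ballI impI)
  have nonneg: "\<And>i \<pi>. \<pi> \<in> PP \<Longrightarrow> \<xi> i \<pi> \<ge> 0"
    and sum1: "\<And>\<pi>. \<pi> \<in> PP \<Longrightarrow> (\<Sum>i\<in>UNIV. \<xi> i \<pi>) = 1"
    using assms(2) by (auto simp: polytopic_def)
  show "stabilizable_gain_X PP \<xi> A B (\<lambda>i j. Kb i) (\<lambda>i j. mat 1)"
    if "stabilizable_gain_poly PP \<xi> A B Kb" for Kb
    using assms(2) that by (rule stabilizable_gain_X_if_gain_poly)
  show QLF: "poly_QLF PP \<xi> (closed_loop A B (gain_poly \<xi> Kb)) (poly_quad \<xi> Pb)"
    if "LMI_poly Av B Pb Kb" for Pb Kb
    using assms(2) that by (rule poly_QLF_if_LMI_poly)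
  show stab: "stabilizable_gain_poly PP \<xi> A B Kb" if "LMI_poly Av B Pb Kb" for Pb Kb
    using QLF[OF that]
    by (auto simp: stabilizable_gain_poly_def poly_Q_stabilizable_with_def poly_QS_def)
  show "(\<exists>Kb. stabilizable_gain_poly PP \<xi> A B Kb) \<longleftrightarrow> (\<exists>Pb Kb. LMI_poly Av B Pb Kb)"
    if "strictly_polytopic PP A \<xi> Av"
    using LMI_poly_if_stabilizable[OF that] stab by blast
  fix Pb X Kb Z
  assume LMI: "LMI_X Av B Pb X Kb Z"
  show QLF_X: "poly_QLF PP \<xi> (closed_loop A B (gain_X \<xi> Kb X)) (poly_quad \<xi> Pb)"
    using LMI assms(2) by (rule poly_QLF_if_LMI_X)
  show inv: "invertible (\<Sum>j\<in>UNIV. \<xi> j \<pi> *\<^sub>R X i j)" if "\<pi> \<in> PP" for i \<pi>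
    by (rule LMI_X_invertible[OF LMI]) (use that nonneg sum1 in auto)
  show "stabilizable_gain_X PP \<xi> A B Kb X"
    \<comment> \<open>Nonsingularity at \<open>p (k + 1)\<close> is exactly what makes the gain well
      defined.\<close>
    using QLF_X inv
    by (auto simp: stabilizable_gain_X_def poly_Q_stabilizable_with_def poly_QS_def
        gain_X_well_defined_def param_seqs_def)
qed

end
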